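(* Let $r\ge 1$ and let $S$ be a semigroup that can be generated by $r$ elements. Then $a_n(S)\le a_n(FS_r)$ for all $n$.
   Context: $FS_r$ is the free semigroup of rank $r$, i.e. all non-empty words over an alphabet of $r$ letters under concatenation. The (Rees) index of a subsemigroup $T$ of a semigroup $S$ is $|S\setminus T|$. For a finitely generated semigroup $S$, $a_n(S)$ denotes the number of subsemigroups of $S$ of Rees index exactly $n$. *)

theory Defs
  imports Main "HOL-Library.Extended_Nat"
begin

text \<open>Semigroups are given by a carrier set and a multiplication that is relevant only on it.
  As usual in semigroup theory, semigroups, and in particular subsemigroups, are non-empty.\<close>

locale semigroup_on =
  fixes S :: "'a set" and mult :: "'a \<Rightarrow> 'a \<Rightarrow> 'a"
  assumes nonempty: "S \<noteq> {}"
    and closed: "x \<in> S \<Longrightarrow> y \<in> S \<Longrightarrow> mult x y \<in> S"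
    and assoc: "x \<in> S \<Longrightarrow> y \<in> S \<Longrightarrow> z \<in> S \<Longrightarrow> mult (mult x y) z = mult x (mult y z)"

definition subsemigroup :: "'a set \<Rightarrow> 'a set \<Rightarrow> ('a \<Rightarrow> 'a \<Rightarrow> 'a) \<Rightarrow> bool" where
  "subsemigroup T S mult \<longleftrightarrow> T \<noteq> {} \<and> T \<subseteq> S \<and> (\<forall>x\<in>T. \<forall>y\<in>T. mult x y \<in> T)"

inductive_set generated_subsemigroup :: "('a \<Rightarrow> 'a \<Rightarrow> 'a) \<Rightarrow> 'a set \<Rightarrow> 'a set"
  for mult :: "'a \<Rightarrow> 'a \<Rightarrow> 'a" and A :: "'a set" where
  base: "x \<in> A \<Longrightarrow> x \<in> generated_subsemigroup mult A"
| mult: "x \<in> generated_subsemigroup mult A \<Longrightarrow> y \<in> generated_subsemigroup mult A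
    \<Longrightarrow> mult x y \<in> generated_subsemigroup mult A"

text \<open>The generators \<open>g 0, \<dots>, g (r - 1)\<close> need not be distinct.\<close>

definition generated_by_elements :: "'a set \<Rightarrow> ('a \<Rightarrow> 'a \<Rightarrow> 'a) \<Rightarrow> nat \<Rightarrow> bool" where
  "generated_by_elements S mult r \<longleftrightarrow>
    (\<exists>g :: nat \<Rightarrow> 'a. g ` {..<r} \<subseteq> S \<and> generated_subsemigroup mult (g ` {..<r}) = S)"

text \<open>Unlike \<^const>\<open>card\<close>, this does not identify infinite sets with the empty set.\<close>

definition ecard :: "'a set \<Rightarrow> enat" where
  "ecard A = (if finite A then enat (card A) else \<infinity>)"

definition rees_index :: "'a set \<Rightarrow> 'a set \<Rightarrow> enat" where
  "rees_index S T = ecard (S - T)"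

definition num_subsemigroups :: "'a set \<Rightarrow> ('a \<Rightarrow> 'a \<Rightarrow> 'a) \<Rightarrow> nat \<Rightarrow> enat" where
  "num_subsemigroups S mult n = ecard {T. subsemigroup T S mult \<and> rees_index S T = enat n}"

text \<open>The carrier of the free semigroup of rank \<open>r\<close> on the letters \<open>0, \<dots>, r - 1\<close>;
  its multiplication is list concatenation.\<close>

definition free_semigroup :: "nat \<Rightarrow> nat list set" where
  "free_semigroup r = {w. w \<noteq> [] \<and> set w \<subseteq> {..<r}}"

lemma semigroup_on_free_semigroup:
  assumes "r \<ge> 1"
  shows "semigroup_on (free_semigroup r) (@)"
proof
  have "[0] \<in> free_semigroup r"
    using assms by (simp add: free_semigroup_def)
  then show "free_semigroup r \<noteq> {}" by blast
qed (auto simp: free_semigroup_def)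

end

theory Submission
  imports Defs
begin

text \<open>Let \<open>S\<close> be generated by \<open>g 0, \<dots>, g (r - 1)\<close>. The shortlex-least words representing the
  elements of \<open>S\<close> form a transversal that is closed under taking non-empty factors. Given a
  subsemigroup \<open>T\<close> of index \<open>n\<close>, remove from the free semigroup the \<open>n\<close> least words that represent
  elements outside \<open>T\<close>. If a removed word is a product \<open>u v\<close>, then \<open>u\<close> and \<open>v\<close> are least words and
  one of them represents an element outside \<open>T\<close>; so what remains is a subsemigroup, and it
  determines \<open>T\<close>.\<close>

text \<open>A semigroup need not have an identity, so the empty word gets a dummy value and the
  recursion bottoms out at one-letter words.\<close>

primrec word_value :: "('a \<Rightarrow> 'a \<Rightarrow> 'a) \<Rightarrow> ('b \<Rightarrow> 'a) \<Rightarrow> 'b list \<Rightarrow> 'a" where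
  "word_value mult g [] = undefined"
| "word_value mult g (x # xs) = (if xs = [] then g x else mult (g x) (word_value mult g xs))"

text \<open>\<open>lenlex less_than\<close> is shortlex: total and well-founded on words over the
  naturals, and preserved by appending a fixed word on either side.\<close>

definition least_words :: "('a \<Rightarrow> 'a \<Rightarrow> 'a) \<Rightarrow> (nat \<Rightarrow> 'a) \<Rightarrow> nat \<Rightarrow> nat list set" where
  "least_words mult g r = {w \<in> free_semigroup r. \<forall>v \<in> free_semigroup r.
    word_value mult g v = word_value mult g w \<longrightarrow> (v, w) \<notin> lenlex less_than}"

lemma ecard_mono_inj:
  assumes "inj_on f A" and "f ` A \<subseteq> B"
  shows "ecard A \<le> ecard B"
  using inj_on_finite[OF assms] card_inj_on_le[OF assms] by (simp add: ecard_def)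

lemma append_in_free_semigroup:
  "u \<noteq> [] \<Longrightarrow> v \<noteq> [] \<Longrightarrow>
    u @ v \<in> free_semigroup r \<longleftrightarrow> u \<in> free_semigroup r \<and> v \<in> free_semigroup r"
  by (auto simp: free_semigroup_def)

text \<open>The powers of the letter \<open>0\<close> are pairwise distinct. Infinitude ensures that
  something is left after finitely many words are removed, as subsemigroups must be
  non-empty.\<close>

lemma infinite_free_semigroup:
  assumes "r \<ge> 1"
  shows "infinite (free_semigroup r)"
proof -
  have "inj (\<lambda>k. replicate (Suc k) (0::nat))"
    by (metis (no_types, lifting) injI length_replicate nat.inject)
  moreover have "range (\<lambda>k. replicate (Suc k) 0) \<subseteq> free_semigroup r"
    using assms by (auto simp: free_semigroup_def)
  ultimately show ?thesis
    using finite_subset range_inj_infinite by blast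
qed

text \<open>Totality: of two distinct words with the same value, the larger one is not
  least.\<close>

lemma inj_on_least_words: "inj_on (word_value mult g) (least_words mult g r)"
proof
  fix u v
  assume "u \<in> least_words mult g r" "v \<in> least_words mult g r"
    "word_value mult g u = word_value mult g v"
  moreover have "total (lenlex less_than)" by (simp add: total_lenlex)
  ultimately show "u = v"
    by (auto simp: least_words_def total_on_def)
qed

text \<open>Well-foundedness: each non-empty fibre of the evaluation map has a minimal word.\<close>

lemma word_value_least_words:
  "word_value mult g ` least_words mult g r = word_value mult g ` free_semigroup r"
proof
  show "word_value mult g ` free_semigroup r \<subseteq> word_value mult g ` least_words mult g r"
  proof
    fix s assume "s \<in> word_value mult g ` free_semigroup r"
    then obtain w where "w \<in> {w \<in> free_semigroup r. word_value mult g w = s}" by auto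
    then obtain m where "m \<in> {w \<in> free_semigroup r. word_value mult g w = s}"
      and "\<And>v. (v, m) \<in> lenlex less_than \<Longrightarrow> v \<notin> {w \<in> free_semigroup r. word_value mult g w = s}"
      by (erule wfE_min[OF wf_lenlex[OF wf_less_than]])
    then show "s \<in> word_value mult g ` least_words mult g r"
      by (intro image_eqI[where x = m]) (auto simp: least_words_def)
  qed
qed (auto simp: least_words_def)

context semigroup_on
begin

lemma word_value_closed:
  assumes "g ` {..<r} \<subseteq> S" and "w \<in> free_semigroup r"
  shows "word_value mult g w \<in> S"
  using assms(2)
proof (induction w)
  case (Cons x w)
  then show ?case
    using assms(1) closed by (auto simp: free_semigroup_def)
qed (simp add: free_semigroup_def)

lemma word_value_append:
  assumes "g ` {..<r} \<subseteq> S" and "u \<in> free_semigroup r" and v: "v \<in> free_semigroup r"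
  shows "word_value mult g (u @ v) = mult (word_value mult g u) (word_value mult g v)"
  using assms(2)
proof (induction u)
  case (Cons x u)
  have x: "g x \<in> S" using Cons.prems assms(1) by (auto simp: free_semigroup_def)
  \<comment> \<open>This matters when \<open>u\<close> is empty: \<open>x # v\<close> then falls
    under the product clause of \<open>word_value\<close>.\<close>
  have "v \<noteq> []" using v by (simp add: free_semigroup_def)
  show ?case
  proof (cases "u = []")
    case False
    then have u: "u \<in> free_semigroup r" using Cons.prems by (simp add: free_semigroup_def)
    then show ?thesis
      using False Cons.IH x assoc word_value_closed[OF assms(1)] v by simp
  qed (simp add: \<open>v \<noteq> []\<close>)
qed (simp add: free_semigroup_def)

lemma word_value_surj:
  assumes g: "g ` {..<r} \<subseteq> S" and gen: "generated_subsemigroup mult (g ` {..<r}) = S"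
  shows "word_value mult g ` free_semigroup r = S"
proof
  show "word_value mult g ` free_semigroup r \<subseteq> S"
    using word_value_closed[OF g] by blast
  have "s \<in> word_value mult g ` free_semigroup r"
    if "s \<in> generated_subsemigroup mult (g ` {..<r})" for s
    using that
  proof induction
    case (base s)
    then obtain i where "i < r" "s = g i" by auto
    then show ?case
      by (intro image_eqI[where x = "[i]"]) (auto simp: free_semigroup_def)
  next
    case (mult s t)
    then obtain u v where "u \<in> free_semigroup r" "v \<in> free_semigroup r"
      "s = word_value mult g u" "t = word_value mult g v" by auto
    then show ?case
      by (intro image_eqI[where x = "u @ v"])
        (auto simp: word_value_append[OF g] free_semigroup_def)
  qed
  then show "S \<subseteq> word_value mult g ` free_semigroup r"
    using gen by blast
qed

text \<open>Replacing a factor by a smaller word of the same value would give a smaller word with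
  the value of \<open>u @ v\<close>.\<close>

lemma least_words_factors:
  assumes g: "g ` {..<r} \<subseteq> S"
    and w: "u @ v \<in> least_words mult g r" and "u \<noteq> []" "v \<noteq> []"
  shows "u \<in> least_words mult g r" and "v \<in> least_words mult g r"
proof -
  have uv: "u \<in> free_semigroup r" "v \<in> free_semigroup r"
    using w append_in_free_semigroup[OF assms(3,4)] by (auto simp: least_words_def)
  have least: "(x @ y, u @ v) \<notin> lenlex less_than"
    if "x \<in> free_semigroup r" "y \<in> free_semigroup r"
      "word_value mult g x = word_value mult g u" "word_value mult g y = word_value mult g v" for x y
  proof -
    have "x @ y \<in> free_semigroup r" using that by (auto simp: free_semigroup_def)
    moreover have "word_value mult g (x @ y) = word_value mult g (u @ v)"
      using that uv by (simp add: word_value_append[OF g])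
    ultimately show ?thesis using w by (simp add: least_words_def)
  qed
  \<comment> \<open>A smaller \<open>x\<close> in place of \<open>u\<close> keeps the suffix
    \<open>v\<close>, so the order survives appending.\<close>
  show "u \<in> least_words mult g r"
    using uv least[of _ v] lenlex_append1[where R = less_than and vs = v and ys = v]
    by (auto simp: least_words_def)
  \<comment> \<open>Here the common prefix \<open>u\<close> cancels, which rests on the
    irreflexivity of \<open>less_than\<close>.\<close>
  show "v \<in> least_words mult g r"
    using uv least[of u] by (auto simp: least_words_def irrefl_less_than)
qed

end

theorem proposition2p4:
  fixes S :: "'a set" and mult :: "'a \<Rightarrow> 'a \<Rightarrow> 'a" and r n :: nat
  assumes "r \<ge> 1"
    and "semigroup_on S mult"
    and "generated_by_elements S mult r"
  shows "num_subsemigroups S mult n \<le> num_subsemigroups (free_semigroup r) (@) n"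
proof -
  interpret semigroup_on S mult by fact
  obtain g :: "nat \<Rightarrow> 'a" where g: "g ` {..<r} \<subseteq> S"
    and gen: "generated_subsemigroup mult (g ` {..<r}) = S"
    using assms(3) by (auto simp: generated_by_elements_def)
  let ?F = "free_semigroup r" and ?val = "word_value mult g"
  define removed where "removed T = {w \<in> least_words mult g r. ?val w \<notin> T}" for T
  have removed_subset: "removed T \<subseteq> ?F" for T
    by (auto simp: removed_def least_words_def)
  \<comment> \<open>Least words form a transversal of the evaluation map, so each element outside
    \<open>T\<close> accounts for exactly one removed word; this transfers the index.\<close>
  have bij: "bij_betw ?val (removed T) (S - T)" for T
  proof -
    have "?val ` least_words mult g r = S"
      using word_value_surj[OF g gen] by (simp add: word_value_least_words)
    then have "?val ` removed T = S - T" by (auto simp: removed_def)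
    moreover have "inj_on ?val (removed T)"
      by (rule inj_on_subset[OF inj_on_least_words]) (auto simp: removed_def)
    ultimately show ?thesis by (simp add: bij_betw_def)
  qed
  have "subsemigroup (?F - removed T) ?F (@)" "rees_index ?F (?F - removed T) = enat n"
    if T: "subsemigroup T S mult" "rees_index S T = enat n" for T
  proof -
    have ecard_eq: "ecard (removed T) = ecard (S - T)"
      using bij_betw_same_card[OF bij] bij_betw_finite[OF bij] by (simp add: ecard_def)
    then show "rees_index ?F (?F - removed T) = enat n"
      using T(2) removed_subset by (simp add: rees_index_def double_diff)
    have "finite (removed T)"
      using T(2) ecard_eq by (auto simp: rees_index_def ecard_def split: if_splits)
    then have "infinite (?F - removed T)"
      using infinite_free_semigroup[OF assms(1)] by (rule Diff_infinite_finite)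
    then have "?F - removed T \<noteq> {}" by (metis finite.emptyI)
    moreover have "u @ v \<in> ?F - removed T"
      if uv: "u \<in> ?F - removed T" "v \<in> ?F - removed T" for u v
    proof -
      have ne: "u \<noteq> []" "v \<noteq> []" using uv by (auto simp: free_semigroup_def)
      have "u @ v \<notin> removed T"
      proof
        assume "u @ v \<in> removed T"
        then have "u @ v \<in> least_words mult g r" and val: "?val (u @ v) \<notin> T"
          by (auto simp: removed_def)
        \<comment> \<open>Both factors are least words and were not removed, so their values must
          lie in \<open>T\<close>.\<close>
        then have "?val u \<in> T" "?val v \<in> T"
          using least_words_factors[OF g _ ne] uv by (auto simp: removed_def)
        then show False
          using val T(1) uv by (simp add: word_value_append[OF g] subsemigroup_def)
      qed
      then show ?thesis using uv ne append_in_free_semigroup by blast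
    qed
    ultimately show "subsemigroup (?F - removed T) ?F (@)"
      by (simp add: subsemigroup_def)
  qed
  moreover have "inj_on (\<lambda>T. ?F - removed T) {T. subsemigroup T S mult \<and> rees_index S T = enat n}"
  \<comment> \<open>Explicit left inverse: the words missing from the image evaluate exactly to
    \<open>S - T\<close>, and \<open>T \<subseteq> S\<close> lets a second complement recover
    \<open>T\<close>.\<close>
  proof (rule inj_on_inverseI)
    fix T assume "T \<in> {T. subsemigroup T S mult \<and> rees_index S T = enat n}"
    then have "T \<subseteq> S" by (simp add: subsemigroup_def)
    then show "S - ?val ` (?F - (?F - removed T)) = T"
      using bij[of T] removed_subset[of T] by (simp add: double_diff bij_betw_def)
  qed
  ultimately show ?thesis
    unfolding num_subsemigroups_def by (intro ecard_mono_inj) auto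
qed

end
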